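(* Let $n\ge1$. The family of regular images of the closed unit ball $\overline{B}_n$ and the family of regular images of the sphere $\mathbb{S}^n$ coincide; that is, for each $p\ge1$ and each $S\subset\mathbb{R}^p$, there exists a regular map $f:\overline{B}_n\to\mathbb{R}^p$ with $f(\overline{B}_n)=S$ if and only if there exists a regular map $g:\mathbb{S}^n\to\mathbb{R}^p$ with $g(\mathbb{S}^n)=S$.
   Context: $\overline{B}_n$ denotes the closed unit ball of $\mathbb{R}^n$ centered at the origin and $\mathbb{S}^n:=\{x_1^2+\cdots+x_{n+1}^2=1\}\subset\mathbb{R}^{n+1}$. A regular map on a semialgebraic set $X\subset\mathbb{R}^m$ is a map $f=(f_1,\ldots,f_p):X\to\mathbb{R}^p$ whose components are of the form $f_k=g_k/h_k$ on $X$, where $g_k,h_k\in\mathbb{R}[x_1,\ldots,x_m]$ and $h_k$ does not vanish at any point of $X$. *)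

theory Defs
  imports "HOL-Analysis.Analysis"
begin

(* On real ^ 'm a bounded linear functional is a linear form in the coordinates, so
   real_polynomial_function singles out exactly the evaluations of the elements of
   R[x_1,...,x_m], m = CARD('m). The functions are total; only values on X matter.
   Numerator and denominator may depend on the component k, and are global on X. *)
definition regular_map_on :: "(real ^ 'm) set \<Rightarrow> (real ^ 'm \<Rightarrow> real ^ 'p) \<Rightarrow> bool" where
  "regular_map_on X f \<longleftrightarrow>
     (\<forall>k. \<exists>g h. real_polynomial_function g \<and> real_polynomial_function h \<and>
        (\<forall>x\<in>X. h x \<noteq> 0) \<and> (\<forall>x\<in>X. f x $ k = g x / h x))"

end

theory Submission
  imports Defs
begin

text \<open>
  Regular maps compose, so it suffices to find a regular surjection in each direction between
  the closed ball and the sphere: the two spaces then have the same regular images.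

  Forgetting one coordinate maps the sphere onto the ball. In the other direction the ball is
  first placed, by the inverse of stereographic projection, onto the closed hemisphere around
  a pole, with \<open>x\<close> going to the point of height \<open>t = (1 - |x|\<^sup>2) / (1 + |x|\<^sup>2)\<close> and horizontal
  part \<open>(1 + t) x\<close>. The hemisphere is then spread over the whole sphere by doubling the angle
  to the pole: a point \<open>(y, t)\<close> with \<open>t = cos \<theta>\<close> and \<open>|y| = sin \<theta>\<close> goes to \<open>(2 t y, 2 t\<^sup>2 - 1)\<close>,
  whose height is \<open>cos (2 \<theta>)\<close> and whose horizontal part has length \<open>sin (2 \<theta>)\<close>. As \<open>\<theta>\<close> runs
  through \<open>[0, \<pi>/2]\<close>, \<open>2 \<theta>\<close> runs through \<open>[0, \<pi>]\<close>, so every point is reached; the equator is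
  collapsed to the opposite pole. The only denominator is \<open>1 + |x|\<^sup>2\<close>, which has no zeros.
\<close>

section \<open>Regular functions and composition\<close>

definition regular_fun_on :: "(real ^ 'm) set \<Rightarrow> (real ^ 'm \<Rightarrow> real) \<Rightarrow> bool" where
  "regular_fun_on X f \<longleftrightarrow>
     (\<exists>g h. real_polynomial_function g \<and> real_polynomial_function h \<and>
        (\<forall>x\<in>X. h x \<noteq> 0) \<and> (\<forall>x\<in>X. f x = g x / h x))"

lemma regular_map_on_iff_components:
  "regular_map_on X f \<longleftrightarrow> (\<forall>k. regular_fun_on X (\<lambda>x. f x $ k))"
  unfolding regular_map_on_def regular_fun_on_def by simp

lemma regular_fun_on_polynomial:
  assumes "real_polynomial_function f"
  shows "regular_fun_on X f"
  unfolding regular_fun_on_def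
  by (rule exI[of _ f], rule exI[of _ "\<lambda>_. 1"])
     (simp add: assms real_polynomial_function.intros(2))

lemma regular_fun_on_const: "regular_fun_on X (\<lambda>_. c)"
  by (intro regular_fun_on_polynomial real_polynomial_function.intros(2))

lemma regular_fun_on_component: "regular_fun_on X (\<lambda>x. x $ i)"
  by (intro regular_fun_on_polynomial real_polynomial_function.intros(1) bounded_linear_vec_nth)

lemma regular_fun_on_add:
  assumes "regular_fun_on X f" "regular_fun_on X f'"
  shows "regular_fun_on X (\<lambda>x. f x + f' x)"
proof -
  obtain g h g' h' where *:
    "real_polynomial_function g" "real_polynomial_function h"
    "real_polynomial_function g'" "real_polynomial_function h'"
    "\<forall>x\<in>X. h x \<noteq> 0" "\<forall>x\<in>X. f x = g x / h x"
    "\<forall>x\<in>X. h' x \<noteq> 0" "\<forall>x\<in>X. f' x = g' x / h' x"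
    using assms unfolding regular_fun_on_def by blast
  show ?thesis
    unfolding regular_fun_on_def
    by (rule exI[of _ "\<lambda>x. g x * h' x + g' x * h x"], rule exI[of _ "\<lambda>x. h x * h' x"])
       (use * in \<open>auto intro!: real_polynomial_function.intros(3,4) simp: add_frac_eq\<close>)
qed

lemma regular_fun_on_mult:
  assumes "regular_fun_on X f" "regular_fun_on X f'"
  shows "regular_fun_on X (\<lambda>x. f x * f' x)"
proof -
  obtain g h g' h' where *:
    "real_polynomial_function g" "real_polynomial_function h"
    "real_polynomial_function g'" "real_polynomial_function h'"
    "\<forall>x\<in>X. h x \<noteq> 0" "\<forall>x\<in>X. f x = g x / h x"
    "\<forall>x\<in>X. h' x \<noteq> 0" "\<forall>x\<in>X. f' x = g' x / h' x"
    using assms unfolding regular_fun_on_def by blast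
  show ?thesis
    unfolding regular_fun_on_def
    by (rule exI[of _ "\<lambda>x. g x * g' x"], rule exI[of _ "\<lambda>x. h x * h' x"])
       (use * in \<open>auto intro!: real_polynomial_function.intros(4)\<close>)
qed

lemma regular_fun_on_inverse:
  assumes "regular_fun_on X f" "\<And>x. x \<in> X \<Longrightarrow> f x \<noteq> 0"
  shows "regular_fun_on X (\<lambda>x. inverse (f x))"
proof -
  obtain g h where *:
    "real_polynomial_function g" "real_polynomial_function h"
    "\<forall>x\<in>X. h x \<noteq> 0" "\<forall>x\<in>X. f x = g x / h x"
    using assms(1) unfolding regular_fun_on_def by blast
  show ?thesis
    unfolding regular_fun_on_def
    by (rule exI[of _ h], rule exI[of _ g]) (use * assms(2) in auto)
qed

lemma regular_fun_on_divide:
  assumes "regular_fun_on X f" "regular_fun_on X f'" "\<And>x. x \<in> X \<Longrightarrow> f' x \<noteq> 0"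
  shows "regular_fun_on X (\<lambda>x. f x / f' x)"
  unfolding divide_inverse
  by (intro regular_fun_on_mult regular_fun_on_inverse assms)

lemma regular_fun_on_diff:
  assumes "regular_fun_on X f" "regular_fun_on X f'"
  shows "regular_fun_on X (\<lambda>x. f x - f' x)"
  using regular_fun_on_add[OF assms(1) regular_fun_on_mult[OF regular_fun_on_const[of X "-1"] assms(2)]]
  by simp

lemma regular_fun_on_sum:
  assumes "finite I" "\<And>i. i \<in> I \<Longrightarrow> regular_fun_on X (f i)"
  shows "regular_fun_on X (\<lambda>x. \<Sum>i\<in>I. f i x)"
  using assms by (induction I rule: finite_induct) (auto intro: regular_fun_on_const regular_fun_on_add)

lemma regular_fun_on_cong:
  assumes "\<And>x. x \<in> X \<Longrightarrow> f x = f' x"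
  shows "regular_fun_on X f \<longleftrightarrow> regular_fun_on X f'"
  using assms unfolding regular_fun_on_def by simp

lemma norm_squared_eq_sum:
  fixes x :: "real ^ 'm"
  shows "(norm x)\<^sup>2 = (\<Sum>i\<in>UNIV. (x $ i)\<^sup>2)"
  by (simp only: power2_norm_eq_inner inner_vec_def inner_real_def) (simp only: power2_eq_square)

lemma regular_fun_on_norm_squared: "regular_fun_on X (\<lambda>x. (norm x)\<^sup>2)"
  unfolding norm_squared_eq_sum unfolding power2_eq_square
  by (intro regular_fun_on_sum regular_fun_on_mult regular_fun_on_component) simp

text \<open>
  Regular functions form a ring, and the substitution of regular functions into a polynomial only
  uses ring operations. Linear forms are the base case of the induction: such a form is the
  combination of the coordinates whose coefficients are its values on the standard basis.
\<close>

lemma regular_fun_on_polynomial_compose: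
  assumes "real_polynomial_function p" and F: "regular_map_on X F"
  shows "regular_fun_on X (\<lambda>x. p (F x))"
  using assms(1)
proof induction
  case (linear p)
  have "p (F x) = (\<Sum>i\<in>UNIV. F x $ i * p (axis i 1))" for x
  proof -
    have "p (F x) = p (\<Sum>i\<in>UNIV. F x $ i *\<^sub>R axis i 1)"
      by (simp add: basis_expansion flip: scalar_mult_eq_scaleR)
    then show ?thesis
      using linear by (simp add: bounded_linear.linear linear_sum linear_cmul)
  qed
  then show ?case
    using F by (auto intro!: regular_fun_on_sum regular_fun_on_mult regular_fun_on_const
        simp: regular_map_on_iff_components)
qed (auto intro: regular_fun_on_const regular_fun_on_add regular_fun_on_mult)

text \<open>
  After substitution, numerator and denominator are themselves fractions, and the new denominator
  has no zeros because \<open>F\<close> takes its values where the old one has none.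
\<close>

lemma regular_map_on_compose:
  assumes f: "regular_map_on Y f" and F: "regular_map_on X F" and "F ` X \<subseteq> Y"
  shows "regular_map_on X (f \<circ> F)"
  unfolding regular_map_on_iff_components
proof
  fix k
  obtain g h where gh: "real_polynomial_function g" "real_polynomial_function h"
      "\<forall>y\<in>Y. h y \<noteq> 0" "\<forall>y\<in>Y. f y $ k = g y / h y"
    using f[unfolded regular_map_on_def, rule_format, of k] by (elim exE conjE)
  have "regular_fun_on X (\<lambda>x. g (F x) / h (F x))"
    using gh assms(3) by (intro regular_fun_on_divide regular_fun_on_polynomial_compose F) auto
  then show "regular_fun_on X (\<lambda>x. (f \<circ> F) x $ k)"
    using gh assms(3) by (subst regular_fun_on_cong[where f' = "\<lambda>x. g (F x) / h (F x)"]) auto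
qed

lemma regular_image_transfer:
  assumes "regular_map_on X F" "F ` X = Y" "regular_map_on Y f" "f ` Y = S"
  shows "\<exists>g. regular_map_on X g \<and> g ` X = S"
proof (intro exI conjI)
  show "regular_map_on X (f \<circ> F)"
    by (rule regular_map_on_compose[OF assms(3,1)]) (simp add: assms(2))
  show "(f \<circ> F) ` X = S"
    unfolding image_comp[symmetric] assms(2,4) ..
qed

section \<open>Horizontal part and height\<close>

text \<open>
  A bijection \<open>e\<close> from \<open>'n option\<close> to \<open>'m\<close> identifies the space indexed by \<open>'m\<close> with pairs
  of a horizontal vector indexed by \<open>'n\<close> and a height, the coordinate at \<open>e None\<close>.
\<close>

definition join_height :: "('n option \<Rightarrow> 'm) \<Rightarrow> real ^ 'n \<Rightarrow> real \<Rightarrow> real ^ 'm" where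
  "join_height e y t = (\<chi> j. case inv e j of None \<Rightarrow> t | Some i \<Rightarrow> y $ i)"

definition horizontal_part :: "('n option \<Rightarrow> 'm) \<Rightarrow> real ^ 'm \<Rightarrow> real ^ 'n" where
  "horizontal_part e v = (\<chi> i. v $ e (Some i))"

lemma horizontal_part_join_height:
  assumes "bij e"
  shows "horizontal_part e (join_height e y t) = y"
  using assms by (simp add: horizontal_part_def join_height_def vec_eq_iff bij_is_inj)

lemma join_height_horizontal_part:
  assumes "bij e"
  shows "join_height e (horizontal_part e v) (v $ e None) = v"
proof -
  have "(case inv e j of None \<Rightarrow> v $ e None | Some i \<Rightarrow> horizontal_part e v $ i) =
      v $ e (inv e j)" for j
    by (simp add: horizontal_part_def split: option.split)
  then show ?thesis
    using assms by (simp add: join_height_def vec_eq_iff bij_is_surj surj_f_inv_f)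
qed

lemma norm_join_height:
  assumes "bij e"
  shows "(norm (join_height e y t))\<^sup>2 = (norm y)\<^sup>2 + t\<^sup>2"
proof -
  let ?v = "join_height e y t"
  have "(norm ?v)\<^sup>2 = (\<Sum>j\<in>UNIV. (?v $ j)\<^sup>2)"
    by (simp only: norm_squared_eq_sum)
  also have "\<dots> = (\<Sum>k\<in>UNIV. (?v $ e k)\<^sup>2)"
    by (rule sum.reindex_bij_betw[OF assms, symmetric])
  also have "\<dots> = (\<Sum>k\<in>UNIV. (case k of None \<Rightarrow> t | Some i \<Rightarrow> y $ i)\<^sup>2)"
    using assms by (simp add: join_height_def bij_is_inj)
  also have "\<dots> = t\<^sup>2 + (\<Sum>i\<in>UNIV. (y $ i)\<^sup>2)"
    by (simp add: UNIV_option_conv sum.reindex)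
  also have "\<dots> = (norm y)\<^sup>2 + t\<^sup>2"
    by (simp only: norm_squared_eq_sum)
  finally show ?thesis .
qed

lemma join_height_in_sphere_iff:
  assumes "bij e"
  shows "join_height e y t \<in> sphere 0 1 \<longleftrightarrow> (norm y)\<^sup>2 + t\<^sup>2 = 1"
  using norm_join_height[OF assms, of y t] power2_eq_1_iff[of "norm (join_height e y t)"]
    norm_ge_zero[of "join_height e y t"] by auto

lemma regular_map_on_join_height:
  assumes "regular_map_on X y" "regular_fun_on X t"
  shows "regular_map_on X (\<lambda>x. join_height e (y x) (t x))"
  unfolding regular_map_on_iff_components
proof
  fix j
  show "regular_fun_on X (\<lambda>x. join_height e (y x) (t x) $ j)"
    using assms by (cases "inv e j") (auto simp: join_height_def regular_map_on_iff_components)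
qed

lemma regular_map_on_horizontal_part: "regular_map_on X (horizontal_part e)"
  by (simp add: regular_map_on_iff_components horizontal_part_def regular_fun_on_component)

lemma horizontal_part_sphere:
  assumes "bij e"
  shows "horizontal_part e ` sphere 0 1 = cball 0 1"
proof (intro equalityI subsetI)
  fix y assume "y \<in> horizontal_part e ` sphere 0 1"
  then obtain v where v: "v \<in> sphere 0 1" "y = horizontal_part e v" by blast
  then have "(norm y)\<^sup>2 + (v $ e None)\<^sup>2 = 1"
    using join_height_in_sphere_iff[OF assms, of y "v $ e None"]
    by (simp only: join_height_horizontal_part[OF assms])
  then have "(norm y)\<^sup>2 \<le> 1\<^sup>2"
    using zero_le_power2[of "v $ e None"] unfolding power_one by linarith
  then show "y \<in> cball 0 1"
    using power2_le_imp_le[of "norm y" 1] by simp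
next
  fix y :: "real ^ 'a" assume "y \<in> cball 0 1"
  then have "(norm y)\<^sup>2 \<le> 1"
    by (simp add: power_le_one)
  then have "join_height e y (sqrt (1 - (norm y)\<^sup>2)) \<in> sphere 0 1"
    unfolding join_height_in_sphere_iff[OF assms] by simp
  then show "y \<in> horizontal_part e ` sphere 0 1"
    using horizontal_part_join_height[OF assms] by (metis image_eqI)
qed

section \<open>From the ball onto the sphere\<close>

definition stereographic_height :: "'a::real_normed_vector \<Rightarrow> real" where
  "stereographic_height x = (1 - (norm x)\<^sup>2) / (1 + (norm x)\<^sup>2)"

lemma one_plus_norm_squared_neq_0: "1 + (norm x)\<^sup>2 \<noteq> (0::real)"
  using zero_le_power2[of "norm x"] by linarith

text \<open>
  This identity places the inverse stereographic image of \<open>x\<close>, with horizontal part \<open>(1 + t) x\<close>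
  and height \<open>t\<close>, on the unit sphere. Since \<open>1 + t = 2 / (1 + r)\<close> for \<open>r = |x|\<^sup>2\<close>, it comes down
  to \<open>4 r + (1 - r)\<^sup>2 = (1 + r)\<^sup>2\<close>.
\<close>

lemma stereographic_height_on_sphere:
  fixes x :: "'a::real_normed_vector"
  defines "t \<equiv> stereographic_height x"
  shows "(1 + t)\<^sup>2 * (norm x)\<^sup>2 + t\<^sup>2 = 1"
proof -
  have 1: "1 + t = 2 / (1 + (norm x)\<^sup>2)"
    using one_plus_norm_squared_neq_0[of x]
    by (simp add: t_def stereographic_height_def field_simps)
  have 2: "(4 * r + (1 - r)\<^sup>2) / (1 + r)\<^sup>2 = 1" if "1 + r \<noteq> 0" for r :: real
  proof -
    have "4 * r + (1 - r)\<^sup>2 = (1 + r)\<^sup>2" by algebra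
    then show ?thesis using that by simp
  qed
  show ?thesis
    using 2[OF one_plus_norm_squared_neq_0[of x]]
    unfolding 1 by (simp add: t_def stereographic_height_def power_divide add_divide_distrib)
qed

text \<open>
  Angle doubling \<open>(y, t) \<mapsto> (2 t y, 2 t\<^sup>2 - 1)\<close> applied to the inverse stereographic image
  \<open>((1 + t) x, t)\<close>.
\<close>

definition ball_to_sphere :: "('n option \<Rightarrow> 'm) \<Rightarrow> real ^ 'n \<Rightarrow> real ^ 'm" where
  "ball_to_sphere e x =
     (let t = stereographic_height x in join_height e ((2 * t * (1 + t)) *\<^sub>R x) (2 * t\<^sup>2 - 1))"

lemma regular_map_on_ball_to_sphere: "regular_map_on X (ball_to_sphere e)"
proof -
  have t: "regular_fun_on X stereographic_height"
    unfolding stereographic_height_def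
    by (intro regular_fun_on_divide regular_fun_on_diff regular_fun_on_add regular_fun_on_const
        regular_fun_on_norm_squared one_plus_norm_squared_neq_0)
  show ?thesis
    unfolding ball_to_sphere_def Let_def
  proof (rule regular_map_on_join_height)
    show "regular_fun_on X (\<lambda>x. 2 * (stereographic_height x)\<^sup>2 - 1)"
      unfolding power2_eq_square
      by (intro regular_fun_on_diff regular_fun_on_mult regular_fun_on_const t)
    show "regular_map_on X
        (\<lambda>x. (2 * stereographic_height x * (1 + stereographic_height x)) *\<^sub>R x)"
      unfolding regular_map_on_iff_components vector_scaleR_component real_scaleR_def
      by (intro allI regular_fun_on_mult regular_fun_on_add regular_fun_on_const
          regular_fun_on_component t)
  qed
qed

lemma ball_to_sphere_in_sphere:
  assumes "bij e"
  shows "ball_to_sphere e x \<in> sphere 0 1"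
proof -
  define t where "t = stereographic_height x"
  have "(1 + t)\<^sup>2 * (norm x)\<^sup>2 + t\<^sup>2 = 1"
    unfolding t_def by (rule stereographic_height_on_sphere)
  then have "(2 * t * (1 + t) * norm x)\<^sup>2 + (2 * t\<^sup>2 - 1)\<^sup>2 = 1"
    by algebra
  then show ?thesis
    unfolding ball_to_sphere_def Let_def t_def[symmetric] join_height_in_sphere_iff[OF assms]
    by (simp add: power_mult_distrib)
qed

text \<open>
  A point of height \<open>s = cos (2 \<theta>)\<close> comes from the point of the hemisphere of height
  \<open>t = cos \<theta> = sqrt ((1 + s) / 2)\<close> in the same horizontal direction, and
  dividing the horizontal part by \<open>2 t (1 + t)\<close> recovers the point of the ball. At the pole
  \<open>s = -1\<close> this divisor vanishes, and any point of the boundary of the ball will do.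
\<close>

lemma ball_to_sphere_surj:
  fixes e :: "'n::finite option \<Rightarrow> 'm::finite"
  assumes "bij e" "v \<in> sphere 0 1"
  obtains x where "x \<in> cball 0 1" "ball_to_sphere e x = v"
proof -
  define z where "z = horizontal_part e v"
  define s where "s = v $ e None"
  have v: "v = join_height e z s"
    unfolding z_def s_def join_height_horizontal_part[OF assms(1)] ..
  have zs: "(norm z)\<^sup>2 + s\<^sup>2 = 1"
    using assms(2) unfolding v join_height_in_sphere_iff[OF assms(1)] .
  have "s\<^sup>2 \<le> 1" using zs zero_le_power2[of "norm z"] by linarith
  then have s: "-1 \<le> s" "s \<le> 1" by (simp_all add: abs_square_le_1 abs_le_iff)
  show thesis
  proof (cases "s = -1")
    case True
    define x where "x = (axis undefined 1 :: real ^ 'n)"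
    have "norm x = 1" by (simp add: x_def)
    moreover have "z = 0" using zs True by simp
    ultimately have "ball_to_sphere e x = v"
      by (simp add: ball_to_sphere_def stereographic_height_def v True)
    with \<open>norm x = 1\<close> show thesis by (intro that[of x]) simp_all
  next
    case False
    define t where "t = sqrt ((1 + s) / 2)"
    have t2: "2 * t\<^sup>2 - 1 = s" using s by (simp add: t_def field_simps)
    have t: "0 < t" "t \<le> 1" using s False by (simp_all add: t_def)
    define c where "c = 2 * t * (1 + t)"
    have c: "0 < c" using t by (simp add: c_def)
    define x where "x = z /\<^sub>R c"
    have "(norm z)\<^sup>2 = c\<^sup>2 * ((1 - t) / (1 + t))"
    proof -
      have "(norm z)\<^sup>2 * (1 + t) = c\<^sup>2 * (1 - t)"
        using zs t2 unfolding c_def by algebra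
      then show ?thesis using t by (simp add: eq_divide_eq)
    qed
    moreover have "norm x = norm z / c"
      using c by (simp add: x_def divide_inverse_commute)
    ultimately have r: "(norm x)\<^sup>2 = (1 - t) / (1 + t)"
      using c by (simp add: power_divide)
    have "stereographic_height x = t"
      using t by (simp add: stereographic_height_def r field_simps)
    moreover have "c *\<^sub>R x = z" using c by (simp add: x_def)
    ultimately have "ball_to_sphere e x = v"
      unfolding ball_to_sphere_def Let_def v using t2 by (simp add: c_def)
    moreover have "(norm x)\<^sup>2 \<le> 1\<^sup>2" using t r by simp
    then have "x \<in> cball 0 1" using power2_le_imp_le[of "norm x" 1] by simp
    ultimately show thesis using that by blast
  qed
qed

theorem corollaryA5:
  fixes S :: "(real ^ 'p) set"
  assumes "CARD('m) = CARD('n) + 1"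
  shows "(\<exists>f :: real ^ 'n \<Rightarrow> real ^ 'p. regular_map_on (cball 0 1) f \<and> f ` cball 0 1 = S) \<longleftrightarrow>
         (\<exists>g :: real ^ 'm \<Rightarrow> real ^ 'p. regular_map_on (sphere 0 1) g \<and> g ` sphere 0 1 = S)"
proof -
  have "CARD('n option) = CARD('m)"
    using assms by (simp add: UNIV_option_conv card_image)
  then obtain e :: "'n option \<Rightarrow> 'm" where e: "bij e"
    using finite_same_card_bij[of "UNIV :: 'n option set" "UNIV :: 'm set"] by auto
  have "ball_to_sphere e ` cball 0 1 = sphere 0 1"
  proof (intro equalityI subsetI)
    fix v assume "v \<in> sphere (0 :: real ^ 'm) 1"
    with e obtain x where "x \<in> cball 0 1" "ball_to_sphere e x = v"
      by (rule ball_to_sphere_surj)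
    then show "v \<in> ball_to_sphere e ` cball 0 1" by blast
  qed (use ball_to_sphere_in_sphere[OF e] in blast)
  then show ?thesis
    by (intro iffI; elim exE conjE)
       (rule regular_image_transfer[OF regular_map_on_horizontal_part horizontal_part_sphere[OF e]],
         assumption+,
        rule regular_image_transfer[OF regular_map_on_ball_to_sphere], assumption+)
qed

end
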